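(* Let $\bm{A}_f\in\mathbb{R}^{m\times n}$, let $\bm{D}\in\mathbb{R}^{n\times n_c}$, let $\bm{A}_c=\bm{A}_f\bm{D}\in\mathbb{R}^{m\times n_c}$ be the corresponding coarse grid sketch, and let $1\le k\le\min(m,n_c)$. Let $\bm{M}\in\mathbb{R}^{n_c\times n}$ and $\bm{E}_I\in\mathbb{R}^{m\times n}$ satisfy $\bm{A}_f=\bm{A}_c\bm{M}+\bm{E}_I$. Let $\bm{A}_c=\bm{U}_c\bm{S}_c\bm{V}_c^T$ be a singular value decomposition with singular values in non-increasing order, and let $\sigma_{c,k+1}$ be the $(k+1)$-th largest singular value of $\bm{A}_c$. Let $\tilde{\bm{U}}_k$ consist of the first $k$ columns of $\bm{U}_c$, let $\tilde{\bm{S}}_k$ be the leading $k\times k$ block of $\bm{S}_c$, and let $\tilde{\bm{V}}_k=\bm{A}_f^T\tilde{\bm{U}}_k\tilde{\bm{S}}_k^{+}$. Then $$\Vert \bm{A}_f-\tilde{\bm{U}}_k\tilde{\bm{S}}_k\tilde{\bm{V}}_k^T\Vert_2\le \Vert\bm{M}\Vert_2\,\sigma_{c,k+1}+\Vert\bm{E}_I\Vert_2 .$$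
   Context: $\Vert\cdot\Vert_2$ is the matrix 2-norm (spectral norm) and ${}^{+}$ denotes the Moore-Penrose pseudoinverse. The fine grid data matrix is $\bm{A}_f$; a coarse grid sketch is a matrix $\bm{A}_c=\bm{A}_f\bm{D}$ for a fixed (deterministic) matrix $\bm{D}$. A singular value whose index exceeds the number of singular values of the matrix is taken to be $0$. *)

theory Defs
  imports
    Complex_Main
    "HOL-Library.Multiset"
    "HOL-Computational_Algebra.Polynomial"
    "Jordan_Normal_Form.Char_Poly"
begin

definition vec_norm2 :: "real vec \<Rightarrow> real" where
  "vec_norm2 v = sqrt (v \<bullet> v)"

text \<open>The supremum is over the unit ball rather than the unit sphere, so that the set is nonempty
  (and the norm is 0) also for a matrix without columns.\<close>

definition spectral_norm :: "real mat \<Rightarrow> real" where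
  "spectral_norm A =
     Sup {vec_norm2 (A *\<^sub>v x) | x. x \<in> carrier_vec (dim_col A) \<and> vec_norm2 x \<le> 1}"

text \<open>The four Penrose conditions. Such an \<open>X\<close> exists and is unique for every real matrix.\<close>

definition is_pinv :: "real mat \<Rightarrow> real mat \<Rightarrow> bool" where
  "is_pinv A X \<longleftrightarrow>
     X \<in> carrier_mat (dim_col A) (dim_row A) \<and>
     A * X * A = A \<and>
     X * A * X = X \<and>
     (A * X)\<^sup>T = A * X \<and>
     (X * A)\<^sup>T = X * A"

definition pinv :: "real mat \<Rightarrow> real mat" where
  "pinv A = (THE X. is_pinv A X)"

text \<open>The \<open>min m n\<close> singular values of an \<open>m \<times> n\<close> matrix in non-increasing order: square roots of
  the largest eigenvalues of \<open>A\<^sup>T A\<close>, repeated according to algebraic multiplicity. That matrix is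
  symmetric positive semidefinite, so it has \<open>n\<close> real eigenvalues, all nonnegative; those
  cut off by \<open>take\<close> when \<open>m < n\<close> are zero.\<close>

definition singular_values :: "real mat \<Rightarrow> real list" where
  "singular_values A =
     take (min (dim_row A) (dim_col A))
       (rev (sorted_list_of_multiset (image_mset sqrt (proots (char_poly (A\<^sup>T * A))))))"

text \<open>The \<open>j\<close>-th largest singular value, with \<open>j\<close> counted from 1.\<close>

definition singular_value :: "real mat \<Rightarrow> nat \<Rightarrow> real" where
  "singular_value A j =
     (if 1 \<le> j \<and> j \<le> length (singular_values A) then singular_values A ! (j - 1) else 0)"

text \<open>Both shapes in use are admitted: the full decomposition, with square orthogonal
  \<open>U\<close> and \<open>V\<close>, and the thin one, with a square \<open>S\<close> of size \<open>min m n\<close>.\<close>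

definition is_svd :: "real mat \<Rightarrow> real mat \<Rightarrow> real mat \<Rightarrow> real mat \<Rightarrow> bool" where
  "is_svd A U S V \<longleftrightarrow>
     (\<exists>p q. (p = dim_row A \<and> q = dim_col A \<or>
             p = min (dim_row A) (dim_col A) \<and> q = min (dim_row A) (dim_col A)) \<and>
       U \<in> carrier_mat (dim_row A) p \<and> S \<in> carrier_mat p q \<and> V \<in> carrier_mat (dim_col A) q \<and>
       U\<^sup>T * U = 1\<^sub>m p \<and> V\<^sup>T * V = 1\<^sub>m q \<and>
       diagonal_mat S \<and>
       (\<forall>i < min p q. 0 \<le> S $$ (i, i)) \<and>
       (\<forall>i j. i \<le> j \<and> j < min p q \<longrightarrow> S $$ (j, j) \<le> S $$ (i, i)) \<and>
       A = U * S * V\<^sup>T)"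

text \<open>The leading \<open>r \<times> c\<close> block; taking \<open>r\<close> to be the number of rows gives the first \<open>c\<close> columns.\<close>

definition leading_block :: "nat \<Rightarrow> nat \<Rightarrow> 'a mat \<Rightarrow> 'a mat" where
  "leading_block r c A = mat r c (\<lambda>(i, j). A $$ (i, j))"

end

theory Submission
  imports Defs "HOL-Analysis.L2_Norm"
begin

text \<open>
  Put \<open>Q = U\<^sub>k S\<^sub>k S\<^sub>k\<^sup>+ U\<^sub>k\<^sup>T\<close>. Since \<open>S\<^sub>k\<^sup>+\<close> is symmetric, the definition of \<open>V\<^sub>k\<close> turns the approximation
  \<open>U\<^sub>k S\<^sub>k V\<^sub>k\<^sup>T\<close> into \<open>Q A\<^sub>f\<close>, and \<open>Q\<close> is the orthogonal projector onto the span of those of the first \<open>k\<close>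
  left singular vectors of \<open>A\<^sub>c\<close> that belong to nonzero singular values
  (\<open>truncated_factor_projector\<close>, \<open>orthonormal_01_projector\<close>). Hence the error is
  \<open>(1 - Q) A\<^sub>f = (1 - Q) A\<^sub>c M + (1 - Q) E\<^sub>I\<close>.

  The second term is at most the norm of \<open>E\<^sub>I\<close>, because \<open>1 - Q\<close> does not increase lengths
  (\<open>vec_norm2_projector_le\<close>). In the first, \<open>(1 - Q) A\<^sub>c\<close> is \<open>A\<^sub>c\<close> with its \<open>k\<close> largest singular values
  replaced by zero, so that it stretches no vector by more than the diagonal entry of \<open>S\<^sub>c\<close> in position
  \<open>k + 1\<close> (\<open>truncation_residual_le\<close>).

  It remains to see that this entry is the singular value \<open>\<sigma>\<^sub>k\<^sub>+\<^sub>1\<close>, which is defined from the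
  characteristic polynomial of \<open>A\<^sub>c\<^sup>T A\<^sub>c\<close> and not from the given decomposition. For this,
  \<open>singular_values_eq_svd_diagonal\<close> compares the characteristic polynomials of \<open>V (S\<^sup>T S V\<^sup>T)\<close> and
  \<open>(S\<^sup>T S V\<^sup>T) V = S\<^sup>T S\<close> by \<open>char_poly_mult_commute\<close>.
\<close>

section \<open>The Euclidean norm and the spectral norm\<close>

lemma vec_norm2_L2: "vec_norm2 v = L2_set (\<lambda>i. v $ i) {..<dim_vec v}"
  by (simp add: vec_norm2_def L2_set_def scalar_prod_def power2_eq_square lessThan_atLeast0)

lemma vec_norm2_sq: "(vec_norm2 v)\<^sup>2 = v \<bullet> v"
  unfolding vec_norm2_def by (rule real_sqrt_pow2) (simp add: scalar_prod_def sum_nonneg)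

lemma vec_norm2_sq_sum: "(vec_norm2 v)\<^sup>2 = (\<Sum>i<dim_vec v. (v $ i)\<^sup>2)"
  unfolding vec_norm2_sq by (simp add: scalar_prod_def power2_eq_square lessThan_atLeast0)

lemma vec_norm2_nonneg [simp]: "0 \<le> vec_norm2 v"
  by (simp add: vec_norm2_L2)

lemma vec_norm2_zero [simp]: "vec_norm2 (0\<^sub>v n) = 0"
  by (simp add: vec_norm2_L2 L2_set_def)

lemma vec_norm2_triangle:
  assumes "v \<in> carrier_vec n" "w \<in> carrier_vec n"
  shows "vec_norm2 (v + w) \<le> vec_norm2 v + vec_norm2 w"
proof -
  have "vec_norm2 (v + w) = L2_set (\<lambda>i. v $ i + w $ i) {..<n}"
    using assms unfolding vec_norm2_L2 by (intro L2_set_cong) auto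
  also have "\<dots> \<le> L2_set (\<lambda>i. v $ i) {..<n} + L2_set (\<lambda>i. w $ i) {..<n}"
    by (rule L2_set_triangle_ineq)
  finally show ?thesis
    using assms by (simp add: vec_norm2_L2)
qed

text \<open>Row by row, the Cauchy-Schwarz inequality bounds the entries of \<open>A x\<close>. This is what makes the
  supremum in \<^const>\<open>spectral_norm\<close> one of a bounded set.\<close>

lemma bdd_above_spectral_norm:
  "bdd_above {vec_norm2 (A *\<^sub>v x) | x. x \<in> carrier_vec (dim_col A) \<and> vec_norm2 x \<le> 1}"
proof (rule bdd_aboveI)
  fix t assume "t \<in> {vec_norm2 (A *\<^sub>v x) | x. x \<in> carrier_vec (dim_col A) \<and> vec_norm2 x \<le> 1}"
  then obtain x where x: "x \<in> carrier_vec (dim_col A)" "vec_norm2 x \<le> 1"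
    and t: "t = vec_norm2 (A *\<^sub>v x)" by blast
  have entry: "\<bar>row A i \<bullet> x\<bar> \<le> vec_norm2 (row A i)" for i
  proof -
    have "\<bar>row A i \<bullet> x\<bar> \<le> (\<Sum>j<dim_col A. \<bar>row A i $ j\<bar> * \<bar>x $ j\<bar>)"
      using x(1) sum_abs[of "\<lambda>j. row A i $ j * x $ j" "{..<dim_col A}"]
      by (simp add: scalar_prod_def lessThan_atLeast0 abs_mult)
    also have "\<dots> \<le> vec_norm2 (row A i) * vec_norm2 x"
      using x(1) L2_set_mult_ineq[of "\<lambda>j. row A i $ j" "\<lambda>j. x $ j" "{..<dim_col A}"]
      by (simp add: vec_norm2_L2)
    also have "\<dots> \<le> vec_norm2 (row A i) * 1"
      by (rule mult_left_mono) (use x(2) in auto)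
    finally show ?thesis by simp
  qed
  have "t \<le> (\<Sum>i<dim_row A. \<bar>row A i \<bullet> x\<bar>)"
    using L2_set_le_sum_abs[of "\<lambda>i. (A *\<^sub>v x) $ i" "{..<dim_row A}"] by (simp add: t vec_norm2_L2)
  also have "\<dots> \<le> (\<Sum>i<dim_row A. vec_norm2 (row A i))"
    by (rule sum_mono) (rule entry)
  finally show "t \<le> (\<Sum>i<dim_row A. vec_norm2 (row A i))" .
qed

lemma vec_norm2_mult_le_spectral_norm:
  assumes "A \<in> carrier_mat m n" "x \<in> carrier_vec n" "vec_norm2 x \<le> 1"
  shows "vec_norm2 (A *\<^sub>v x) \<le> spectral_norm A"
  unfolding spectral_norm_def
  by (rule cSup_upper[OF _ bdd_above_spectral_norm]) (use assms in auto)

lemma spectral_norm_le: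
  assumes "A \<in> carrier_mat m n"
    and "\<And>x. x \<in> carrier_vec n \<Longrightarrow> vec_norm2 x \<le> 1 \<Longrightarrow> vec_norm2 (A *\<^sub>v x) \<le> c"
  shows "spectral_norm A \<le> c"
  unfolding spectral_norm_def
proof (rule cSup_least)
  have "0\<^sub>v (dim_col A) \<in> carrier_vec (dim_col A) \<and> vec_norm2 (0\<^sub>v (dim_col A)) \<le> 1"
    by simp
  then show "{vec_norm2 (A *\<^sub>v x) | x. x \<in> carrier_vec (dim_col A) \<and> vec_norm2 x \<le> 1} \<noteq> {}"
    by blast
qed (use assms in auto)

section \<open>Orthogonal projectors and orthonormal columns\<close>

lemma projector_pythagoras:
  assumes Q: "Q \<in> carrier_mat m m" "Q\<^sup>T = Q" "Q * Q = Q" and z: "z \<in> carrier_vec m"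
  shows "(vec_norm2 (z - Q *\<^sub>v z))\<^sup>2 + (vec_norm2 (Q *\<^sub>v z))\<^sup>2 = (vec_norm2 z)\<^sup>2"
proof -
  have w: "Q *\<^sub>v z \<in> carrier_vec m"
    using Q z by simp
  \<comment> \<open>Symmetry and idempotence make \<open>Q z\<close> orthogonal to \<open>z - Q z\<close>.\<close>
  have "(Q *\<^sub>v z) \<bullet> (Q *\<^sub>v z) = z \<bullet> (Q *\<^sub>v (Q *\<^sub>v z))"
    using transpose_vec_mult_scalar[OF Q(1) w z] Q(2) by simp
  also have "Q *\<^sub>v (Q *\<^sub>v z) = Q *\<^sub>v z"
    using assoc_mult_mat_vec[OF Q(1) Q(1) z] Q(3) by simp
  finally have *: "(Q *\<^sub>v z) \<bullet> (Q *\<^sub>v z) = z \<bullet> (Q *\<^sub>v z)" .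
  have "(z - Q *\<^sub>v z) \<bullet> (z - Q *\<^sub>v z) = z \<bullet> z - z \<bullet> (Q *\<^sub>v z) - ((Q *\<^sub>v z) \<bullet> z - (Q *\<^sub>v z) \<bullet> (Q *\<^sub>v z))"
    using w z by (simp add: minus_scalar_prod_distrib[of _ m] scalar_prod_minus_distrib[of _ m])
  also have "(Q *\<^sub>v z) \<bullet> z = z \<bullet> (Q *\<^sub>v z)"
    by (rule comm_scalar_prod[OF w z])
  finally show ?thesis
    using * by (simp add: vec_norm2_sq)
qed

lemma vec_norm2_projector_le:
  assumes "Q \<in> carrier_mat m m" "Q\<^sup>T = Q" "Q * Q = Q" "z \<in> carrier_vec m"
  shows "vec_norm2 (Q *\<^sub>v z) \<le> vec_norm2 z" "vec_norm2 (z - Q *\<^sub>v z) \<le> vec_norm2 z"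
proof -
  have sq: "(vec_norm2 (Q *\<^sub>v z))\<^sup>2 \<le> (vec_norm2 z)\<^sup>2" "(vec_norm2 (z - Q *\<^sub>v z))\<^sup>2 \<le> (vec_norm2 z)\<^sup>2"
    using projector_pythagoras[OF assms] zero_le_power2[of "vec_norm2 (Q *\<^sub>v z)"]
      zero_le_power2[of "vec_norm2 (z - Q *\<^sub>v z)"] by linarith+
  show "vec_norm2 (Q *\<^sub>v z) \<le> vec_norm2 z"
    by (rule power2_le_imp_le[OF sq(1) vec_norm2_nonneg])
  show "vec_norm2 (z - Q *\<^sub>v z) \<le> vec_norm2 z"
    by (rule power2_le_imp_le[OF sq(2) vec_norm2_nonneg])
qed

lemma vec_norm2_orthonormal_columns:
  assumes U: "U \<in> carrier_mat m p" "U\<^sup>T * U = 1\<^sub>m p" and w: "w \<in> carrier_vec p"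
  shows "vec_norm2 (U *\<^sub>v w) = vec_norm2 w"
proof -
  have "(U *\<^sub>v w) \<bullet> (U *\<^sub>v w) = (U\<^sup>T *\<^sub>v (U *\<^sub>v w)) \<bullet> w"
    using transpose_vec_mult_scalar[OF U(1) w, of "U *\<^sub>v w"] U w by simp
  also have "U\<^sup>T *\<^sub>v (U *\<^sub>v w) = w"
    using assoc_mult_mat_vec[of "U\<^sup>T" p m U p w] U w by simp
  finally show ?thesis by (simp add: vec_norm2_def)
qed

text \<open>Bessel's inequality: \<open>V\<^sup>T y\<close> has the length of the projection \<open>V V\<^sup>T y\<close>.\<close>

lemma vec_norm2_transpose_orthonormal_columns_le:
  assumes V: "V \<in> carrier_mat n q" "V\<^sup>T * V = 1\<^sub>m q" and y: "y \<in> carrier_vec n"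
  shows "vec_norm2 (V\<^sup>T *\<^sub>v y) \<le> vec_norm2 y"
proof -
  let ?Q = "V * V\<^sup>T"
  have VT: "V\<^sup>T \<in> carrier_mat q n" using V by simp
  have Q: "?Q \<in> carrier_mat n n" using V by simp
  have sym: "?Q\<^sup>T = ?Q"
    by (simp add: transpose_mult[OF V(1) VT])
  have "?Q * ?Q = V * ((V\<^sup>T * V) * V\<^sup>T)"
    using V(1) VT by (simp add: assoc_mult_mat[of _ n q _ n _ n] assoc_mult_mat[of _ q n _ q _ n])
  then have idem: "?Q * ?Q = ?Q"
    using V VT by simp
  have "vec_norm2 (V\<^sup>T *\<^sub>v y) = vec_norm2 (?Q *\<^sub>v y)"
    using vec_norm2_orthonormal_columns[OF V, of "V\<^sup>T *\<^sub>v y"] V VT y by simp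
  also have "\<dots> \<le> vec_norm2 y"
    by (rule vec_norm2_projector_le[OF Q sym idem y])
  finally show ?thesis .
qed

section \<open>Rectangular diagonal matrices\<close>

text \<open>All middle factors of the theorem, rectangular or truncated, have this form: the factor \<open>S\<close> of
  either shape, its leading block, the pseudoinverse of that block, and the map that selects the
  first \<open>k\<close> columns. Products of them reduce to products of the entry functions.\<close>

definition rect_diag :: "nat \<Rightarrow> nat \<Rightarrow> (nat \<Rightarrow> 'a :: zero) \<Rightarrow> 'a mat" where
  "rect_diag p q f = mat p q (\<lambda>(i, j). if i = j then f i else 0)"

lemma rect_diag_carrier [simp]: "rect_diag p q f \<in> carrier_mat p q"
  by (simp add: rect_diag_def)

lemma rect_diag_dim [simp]: "dim_row (rect_diag p q f) = p" "dim_col (rect_diag p q f) = q"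
  by (simp_all add: rect_diag_def)

lemma rect_diag_index [simp]:
  "i < p \<Longrightarrow> j < q \<Longrightarrow> rect_diag p q f $$ (i, j) = (if i = j then f i else 0)"
  by (simp add: rect_diag_def)

lemma rect_diag_cong:
  "(\<And>i. i < min p q \<Longrightarrow> f i = g i) \<Longrightarrow> rect_diag p q f = rect_diag p q g"
  by (rule eq_matI) auto

lemma rect_diag_transpose: "(rect_diag p q f)\<^sup>T = rect_diag q p f"
  by (rule eq_matI) auto

lemma rect_diag_mult:
  fixes f g :: "nat \<Rightarrow> 'a :: semiring_0"
  shows "rect_diag p q f * rect_diag q r g = rect_diag p r (\<lambda>i. if i < q then f i * g i else 0)"
proof (rule eq_matI)
  fix i j assume "i < dim_row (rect_diag p r (\<lambda>i. if i < q then f i * g i else 0))"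
    "j < dim_col (rect_diag p r (\<lambda>i. if i < q then f i * g i else 0))"
  then have ij: "i < p" "j < r" by simp_all
  have "(rect_diag p q f * rect_diag q r g) $$ (i, j)
      = (\<Sum>l<q. (if i = l then f i else 0) * (if l = j then g l else 0))"
    using ij by (simp add: scalar_prod_def lessThan_atLeast0)
  also have "\<dots> = (\<Sum>l<q. if l = i then (if i = j then f i * g i else 0) else 0)"
    by (rule sum.cong) auto
  finally show "(rect_diag p q f * rect_diag q r g) $$ (i, j)
      = rect_diag p r (\<lambda>i. if i < q then f i * g i else 0) $$ (i, j)"
    using ij by simp
qed simp_all

lemma diagonal_mat_rect_diag:
  assumes "S \<in> carrier_mat p q" "diagonal_mat S"
  shows "S = rect_diag p q (\<lambda>i. S $$ (i, i))"
  by (rule eq_matI) (use assms in \<open>auto simp: diagonal_mat_def\<close>)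

lemma rect_diag_mult_vec_index:
  fixes f :: "nat \<Rightarrow> 'a :: semiring_0"
  assumes "y \<in> carrier_vec q" "i < p"
  shows "(rect_diag p q f *\<^sub>v y) $ i = (if i < q then f i * y $ i else 0)"
proof -
  have "(rect_diag p q f *\<^sub>v y) $ i = (\<Sum>l<q. (if i = l then f i else 0) * y $ l)"
    using assms by (simp add: scalar_prod_def lessThan_atLeast0)
  also have "\<dots> = (\<Sum>l<q. if l = i then f i * y $ i else 0)"
    by (rule sum.cong) auto
  finally show ?thesis by simp
qed

lemma vec_norm2_rect_diag_mult_le:
  assumes y: "y \<in> carrier_vec q" and c: "0 \<le> c" and f: "\<And>i. i < min p q \<Longrightarrow> \<bar>f i\<bar> \<le> c"
  shows "vec_norm2 (rect_diag p q f *\<^sub>v y) \<le> c * vec_norm2 y"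
proof (rule power2_le_imp_le)
  have "(vec_norm2 (rect_diag p q f *\<^sub>v y))\<^sup>2 = (\<Sum>i<p. ((rect_diag p q f *\<^sub>v y) $ i)\<^sup>2)"
    by (simp add: vec_norm2_sq_sum del: index_mult_mat_vec)
  also have "\<dots> = (\<Sum>i<p. if i < q then (f i * y $ i)\<^sup>2 else 0)"
    by (rule sum.cong) (use y in \<open>simp_all add: rect_diag_mult_vec_index del: index_mult_mat_vec\<close>)
  also have "\<dots> = (\<Sum>i<min p q. (f i * y $ i)\<^sup>2)"
    by (rule sum.mono_neutral_cong_right) auto
  also have "\<dots> \<le> (\<Sum>i<min p q. c\<^sup>2 * (y $ i)\<^sup>2)"
    unfolding power_mult_distrib
    by (intro sum_mono mult_right_mono) (use f c in \<open>auto simp: abs_le_square_iff[symmetric]\<close>)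
  also have "\<dots> \<le> (\<Sum>i<q. c\<^sup>2 * (y $ i)\<^sup>2)"
    by (rule sum_mono2) auto
  also have "\<dots> = (c * vec_norm2 y)\<^sup>2"
    using y by (simp add: power_mult_distrib vec_norm2_sq_sum sum_distrib_left)
  finally show "(vec_norm2 (rect_diag p q f *\<^sub>v y))\<^sup>2 \<le> (c * vec_norm2 y)\<^sup>2" .
qed (use c in simp)

section \<open>The pseudoinverse of a diagonal matrix\<close>

text \<open>If \<open>X\<close> and \<open>Y\<close> are pseudoinverses of \<open>A\<close>, both \<open>A X = (A Y A X)\<^sup>T = A X A Y = A Y\<close> and, likewise,
  \<open>X A = Y A\<close>, so that \<open>X = X A X = Y A X = Y A Y = Y\<close>.\<close>

lemma is_pinv_unique:
  assumes X: "is_pinv A X" and Y: "is_pinv A Y"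
  shows "X = Y"
proof -
  obtain m n where A: "A \<in> carrier_mat m n" by blast
  have cX: "X \<in> carrier_mat n m" and cY: "Y \<in> carrier_mat n m"
    using X Y A by (auto simp: is_pinv_def)
  note a [simp] = A cX cY
  have p: "A * X * A = A" "X * A * X = X" "(A * X)\<^sup>T = A * X" "(X * A)\<^sup>T = X * A"
    "A * Y * A = A" "Y * A * Y = Y" "(A * Y)\<^sup>T = A * Y" "(Y * A)\<^sup>T = Y * A"
    using X Y by (auto simp: is_pinv_def)
  have AX: "A * X \<in> carrier_mat m m" "A * Y \<in> carrier_mat m m" "X * A \<in> carrier_mat n n"
    "Y * A \<in> carrier_mat n n" by (rule mult_carrier_mat[OF A cX] mult_carrier_mat[OF A cY]
      mult_carrier_mat[OF cX A] mult_carrier_mat[OF cY A])+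
  have "A * X = A * Y * A * X" by (simp only: p)
  also have "\<dots> = (A * Y) * (A * X)" using assoc_mult_mat[OF AX(2) A cX] .
  also have "\<dots> = ((A * X) * (A * Y))\<^sup>T"
    unfolding transpose_mult[OF AX(1,2)] p ..
  also have "(A * X) * (A * Y) = A * X * A * Y" using assoc_mult_mat[OF AX(1) A cY] by simp
  also have "\<dots> = A * Y" by (simp only: p)
  finally have 1: "A * X = A * Y" by (simp only: p)
  have "X * A = X * (A * Y * A)" by (simp only: p)
  also have "\<dots> = (X * A) * (Y * A)"
    using assoc_mult_mat[OF cX A AX(4)] assoc_mult_mat[OF A cY A] by simp
  also have "\<dots> = ((Y * A) * (X * A))\<^sup>T"
    unfolding transpose_mult[OF AX(4,3)] p ..
  also have "(Y * A) * (X * A) = Y * (A * X * A)"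
    using assoc_mult_mat[OF cY A AX(3)] assoc_mult_mat[OF A cX A] by simp
  also have "\<dots> = Y * A" by (simp only: p)
  finally have 2: "X * A = Y * A" by (simp only: p)
  have "X = Y * A * X" using p(2) 2 by simp
  also have "\<dots> = Y * (A * X)" by (rule assoc_mult_mat[OF cY A cX])
  also have "\<dots> = Y * A * Y" unfolding 1 by (rule assoc_mult_mat[OF cY A cY, symmetric])
  finally show ?thesis by (simp only: p)
qed

lemma pinv_eqI: "is_pinv A X \<Longrightarrow> pinv A = X"
  unfolding pinv_def by (blast intro: is_pinv_unique)

text \<open>The convention \<open>inverse 0 = 0\<close> of the reals is the pseudoinverse of a scalar.\<close>

lemma pinv_rect_diag:
  fixes f :: "nat \<Rightarrow> real"
  shows "pinv (rect_diag p q f) = rect_diag q p (\<lambda>i. inverse (f i))"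
proof (rule pinv_eqI)
  show "is_pinv (rect_diag p q f) (rect_diag q p (\<lambda>i. inverse (f i)))"
    unfolding is_pinv_def
    by (auto simp: rect_diag_mult rect_diag_transpose intro!: rect_diag_cong right_inverse left_inverse)
qed

section \<open>The singular values are the diagonal of any decomposition\<close>

lemma char_poly_four_block_lower_left:
  fixes A C D :: "'a :: idom mat"
  assumes "A \<in> carrier_mat n n" "C \<in> carrier_mat m n" "D \<in> carrier_mat m m"
  shows "char_poly (four_block_mat A (0\<^sub>m n m) C D) = char_poly A * char_poly D"
proof -
  have "char_poly_matrix (four_block_mat A (0\<^sub>m n m) C D)
     = four_block_mat (char_poly_matrix A) (0\<^sub>m n m) (map_mat (\<lambda>a. [:-a:]) C) (char_poly_matrix D)"
    by (rule eq_matI) (use assms in \<open>auto simp: char_poly_matrix_def\<close>)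
  then show ?thesis
    unfolding char_poly_def
    using det_four_block_mat_upper_right_zero[of "char_poly_matrix A" n "0\<^sub>m n m" m
        "map_mat (\<lambda>a. [:-a:]) C" "char_poly_matrix D"] assms by simp
qed

lemma char_poly_zero_mat: "char_poly (0\<^sub>m n n :: 'a :: idom mat) = [:0, 1:] ^ n"
proof -
  have "char_poly (0\<^sub>m n n :: 'a mat) = (\<Prod>a\<leftarrow>diag_mat (0\<^sub>m n n :: 'a mat). [:- a, 1:])"
    by (rule char_poly_upper_triangular[of _ n]) (auto simp: upper_triangular_def)
  also have "map (\<lambda>a :: 'a. [:- a, 1:]) (diag_mat (0\<^sub>m n n)) = replicate n [:0, 1:]"
    by (rule nth_equalityI) (auto simp: diag_mat_def)
  finally show ?thesis by simp
qed

text \<open>Both products are corner blocks of similar matrices: conjugation by the unipotent matrix with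
  off-diagonal block \<open>A\<close> carries the block matrix with rows \<open>(0, 0)\<close>, \<open>(B, B A)\<close> to the one with rows
  \<open>(A B, 0)\<close>, \<open>(B, 0)\<close>.\<close>

lemma char_poly_mult_commute:
  fixes A B :: "'a :: idom mat"
  assumes A: "A \<in> carrier_mat n m" and B: "B \<in> carrier_mat m n"
  shows "char_poly (A * B) * [:0, 1:] ^ m = [:0, 1:] ^ n * char_poly (B * A)"
proof -
  let ?L = "four_block_mat (A * B) (0\<^sub>m n m) B (0\<^sub>m m m)"
  let ?R = "four_block_mat (0\<^sub>m n n) (0\<^sub>m n m) B (B * A)"
  let ?P = "four_block_mat (1\<^sub>m n) A (0\<^sub>m m n) (1\<^sub>m m)"
  let ?P' = "four_block_mat (1\<^sub>m n) (- A) (0\<^sub>m m n) (1\<^sub>m m)"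
  have AB: "A * B \<in> carrier_mat n n" "B * A \<in> carrier_mat m m" "A * (B * A) \<in> carrier_mat n m"
    "- A \<in> carrier_mat n m" "- (B * A) \<in> carrier_mat m m" "- (A * (B * A)) \<in> carrier_mat n m"
    using A B by auto
  have "similar_mat ?L ?R"
  proof (rule similar_matI[of _ _ ?P ?P' "n + m"])
    note one = one_carrier_mat[of n] one_carrier_mat[of m]
      and zero = zero_carrier_mat[of m n] zero_carrier_mat[of n m]
        zero_carrier_mat[of n n] zero_carrier_mat[of m m]
    have inv: "A + - A = 0\<^sub>m n m" "- A + A = 0\<^sub>m n m"
      "- (A * (B * A)) + A * (B * A) = 0\<^sub>m n m" "- (B * A) + B * A = 0\<^sub>m m m"
      using A AB(2,3) by (auto simp: add_uminus_minus_mat[OF A A])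
    have neg: "- 0\<^sub>m m m = (0\<^sub>m m m :: 'a mat)"
      by (rule eq_matI) simp_all
    show "?P * ?P' = 1\<^sub>m (n + m)"
      unfolding mult_four_block_mat[OF one(1) A zero(1) one(2) one(1) AB(4) zero(1) one(2)]
      using A AB(4) neg by (simp add: inv(2))
    show "?P' * ?P = 1\<^sub>m (n + m)"
      unfolding mult_four_block_mat[OF one(1) AB(4) zero(1) one(2) one(1) A zero(1) one(2)]
      using A AB(4) by (simp add: inv(1))
    have "?P * ?R = four_block_mat (A * B) (A * (B * A)) B (B * A)"
      unfolding mult_four_block_mat[OF one(1) A zero(1) one(2) zero(3) zero(2) B AB(2)]
      using A B AB by simp
    also have "\<dots> * ?P' = ?L"
    proof -
      have "A * B * - A = - (A * (B * A))" "B * - A = - (B * A)"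
        using A B by simp_all
      then show ?thesis
        unfolding mult_four_block_mat[OF AB(1,3) B AB(2) one(1) AB(4) zero(1) one(2)]
        using A B AB neg by (simp add: inv(3,4))
    qed
    finally show "?L = ?P * ?R * ?P'" by simp
  qed (use A B AB in auto)
  then have "char_poly ?L = char_poly ?R"
    by (rule char_poly_similar)
  then show ?thesis
    using A B AB by (simp add: char_poly_four_block_lower_left char_poly_zero_mat)
qed

lemma char_poly_nonzero:
  fixes A :: "'a :: idom mat"
  shows "A \<in> carrier_mat n n \<Longrightarrow> char_poly A \<noteq> 0"
  using degree_monic_char_poly[of A n] by auto

lemma proots_char_poly_mult_commute:
  fixes A B :: "'a :: idom mat"
  assumes A: "A \<in> carrier_mat n m" and B: "B \<in> carrier_mat m n"
  shows "proots (char_poly (A * B)) + replicate_mset m 0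
    = replicate_mset n 0 + proots (char_poly (B * A))"
proof -
  have nz: "char_poly (A * B) \<noteq> 0" "char_poly (B * A) \<noteq> 0" "[:0, 1:] ^ j \<noteq> (0 :: 'a poly)" for j
    using char_poly_nonzero[OF mult_carrier_mat[OF A B]] char_poly_nonzero[OF mult_carrier_mat[OF B A]]
    by simp_all
  have pX: "proots ([:0, 1:] ^ j) = replicate_mset j (0 :: 'a)" for j
    by (simp add: proots_power)
  show ?thesis
    using arg_cong[OF char_poly_mult_commute[OF A B], of proots] nz
    by (simp only: proots_mult pX not_False_eq_True)
qed

lemma char_poly_rect_diag:
  fixes f :: "nat \<Rightarrow> 'a :: idom"
  shows "char_poly (rect_diag q q f) = (\<Prod>a\<leftarrow>map f [0..<q]. [:- a, 1:])"
proof -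
  have "diag_mat (rect_diag q q f) = map f [0..<q]"
    by (rule nth_equalityI) (simp_all add: diag_mat_def)
  then show ?thesis
    using char_poly_upper_triangular[of "rect_diag q q f" q] by (auto simp: upper_triangular_def)
qed

lemma proots_prod_list_linear:
  fixes xs :: "'a :: idom list"
  shows "proots (\<Prod>a\<leftarrow>xs. [:- a, 1:]) = mset xs"
proof (induction xs)
  case (Cons x xs)
  have "(\<Prod>a\<leftarrow>xs. [:- a, 1:]) \<noteq> 0"
    by (auto simp: prod_list_zero_iff)
  then have "proots ([:- x, 1:] * (\<Prod>a\<leftarrow>xs. [:- a, 1:])) = {#x#} + mset xs"
    by (subst proots_mult) (simp_all add: Cons.IH del: mult_pCons_left)
  then show ?case
    by (simp del: mult_pCons_left)
qed simp

text \<open>The full and the thin shape differ in \<open>p\<close> and \<open>q\<close>, but both satisfy \<open>min p q = min m n\<close>; the arguments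
  below rely on this equation alone and so need no case distinction.\<close>

lemma is_svdE:
  assumes "is_svd A U S V"
  obtains m n p q where "A \<in> carrier_mat m n" "min p q = min m n"
    "U \<in> carrier_mat m p" "U\<^sup>T * U = 1\<^sub>m p" "V \<in> carrier_mat n q" "V\<^sup>T * V = 1\<^sub>m q"
    "S = rect_diag p q (\<lambda>i. S $$ (i, i))" "A = U * S * V\<^sup>T"
    "\<And>i. i < min p q \<Longrightarrow> 0 \<le> S $$ (i, i)"
    "\<And>i j. i \<le> j \<Longrightarrow> j < min p q \<Longrightarrow> S $$ (j, j) \<le> S $$ (i, i)"
proof -
  obtain p q where pq: "p = dim_row A \<and> q = dim_col A \<or>
      p = min (dim_row A) (dim_col A) \<and> q = min (dim_row A) (dim_col A)"
    and svd: "U \<in> carrier_mat (dim_row A) p" "S \<in> carrier_mat p q" "V \<in> carrier_mat (dim_col A) q"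
      "U\<^sup>T * U = 1\<^sub>m p" "V\<^sup>T * V = 1\<^sub>m q" "diagonal_mat S" "\<forall>i < min p q. 0 \<le> S $$ (i, i)"
      "\<forall>i j. i \<le> j \<and> j < min p q \<longrightarrow> S $$ (j, j) \<le> S $$ (i, i)" "A = U * S * V\<^sup>T"
    using assms unfolding is_svd_def by (elim exE conjE) (rule that, (assumption | simp only:)+)
  show thesis
    by (rule that[OF _ _ svd(1,4,3,5) diagonal_mat_rect_diag[OF svd(2,6)] svd(9)])
      (use pq svd(7,8) in auto)
qed

text \<open>With \<open>A = U S V\<^sup>T\<close>, the matrix \<open>A\<^sup>T A = V (S\<^sup>T S) V\<^sup>T\<close> has, up to zeros, the spectrum of the diagonal
  matrix \<open>S\<^sup>T S V\<^sup>T V = S\<^sup>T S\<close>. Exchanging the factors \<open>V\<close> and \<open>S\<^sup>T S V\<^sup>T\<close> keeps track of the number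
  of these zeros, and so treats the full and the thin shape alike.\<close>

lemma singular_values_eq_svd_diagonal:
  assumes svd: "is_svd A U S V"
  shows "singular_values A = map (\<lambda>i. S $$ (i, i)) [0..<min (dim_row A) (dim_col A)]"
  using svd
proof (cases rule: is_svdE)
  case (1 m n p q)
  define s where "s i = S $$ (i, i)" for i
  define t where "t i = (if i < p then s i * s i else 0)" for i
  define T where "T = rect_diag q q t"
  define r where "r = min m n"
  have r: "r = min p q" "r \<le> n" "r \<le> q" using 1 by (auto simp: r_def)
  note U = 1(3,4) and V = 1(5,6)
  have Ss: "S = rect_diag p q s"
    using 1(7) by (simp add: s_def[abs_def])
  have S: "S \<in> carrier_mat p q" by (subst Ss) simp
  have T: "T \<in> carrier_mat q q" by (simp add: T_def)
  have tr: "U\<^sup>T \<in> carrier_mat p m" "V\<^sup>T \<in> carrier_mat q n" "S\<^sup>T \<in> carrier_mat q p"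
    using U V S by simp_all
  have SVT: "S * V\<^sup>T \<in> carrier_mat p n" and TVT: "T * V\<^sup>T \<in> carrier_mat q n"
    using S T tr by simp_all
  have "S\<^sup>T * S = T"
    unfolding Ss T_def t_def[abs_def] by (simp add: rect_diag_transpose rect_diag_mult)
  have A: "A = U * (S * V\<^sup>T)"
    using 1(8) assoc_mult_mat[OF U(1) S tr(2)] by simp
  have "A\<^sup>T = V * S\<^sup>T * U\<^sup>T"
    unfolding A transpose_mult[OF U(1) SVT] transpose_mult[OF S tr(2)] by simp
  then have "A\<^sup>T * A = V * S\<^sup>T * U\<^sup>T * (U * (S * V\<^sup>T))"
    by (simp add: A)
  also have "\<dots> = V * S\<^sup>T * ((U\<^sup>T * U) * (S * V\<^sup>T))"
    using assoc_mult_mat[OF mult_carrier_mat[OF V(1) tr(3)] tr(1) mult_carrier_mat[OF U(1) SVT]]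
      assoc_mult_mat[OF tr(1) U(1) SVT] by simp
  also have "\<dots> = V * S\<^sup>T * (S * V\<^sup>T)"
    by (simp only: U(2) left_mult_one_mat[OF SVT])
  also have "\<dots> = V * (S\<^sup>T * S * V\<^sup>T)"
    using assoc_mult_mat[OF V(1) tr(3) SVT] assoc_mult_mat[OF tr(3) S tr(2)] by simp
  finally have ATA: "A\<^sup>T * A = V * (T * V\<^sup>T)"
    by (simp only: \<open>S\<^sup>T * S = T\<close>)
  have "T * V\<^sup>T * V = T"
    using assoc_mult_mat[OF T tr(2) V(1)] V(2) T by simp
  then have eq: "proots (char_poly (A\<^sup>T * A)) + replicate_mset q 0
      = replicate_mset n 0 + mset (map t [0..<q])"
    using proots_char_poly_mult_commute[OF V(1) TVT]
    by (simp only: ATA) (simp only: T_def char_poly_rect_diag proots_prod_list_linear)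
  have "map t [0..<q] = map (\<lambda>i. s i * s i) [0..<r] @ replicate (q - r) 0"
    by (rule nth_equalityI) (use r in \<open>auto simp: nth_append t_def\<close>)
  then have mt: "mset (map t [0..<q]) = mset (map (\<lambda>i. s i * s i) [0..<r]) + replicate_mset (q - r) 0"
    by (simp only: mset_append mset_replicate)
  have zeros: "replicate_mset n 0 + replicate_mset (q - r) (0 :: real)
      = replicate_mset (n - r) 0 + replicate_mset q 0"
    by (rule multiset_eqI) (use r in auto)
  have "proots (char_poly (A\<^sup>T * A)) + replicate_mset q 0
      = mset (map (\<lambda>i. s i * s i) [0..<r]) + (replicate_mset n 0 + replicate_mset (q - r) 0)"
    unfolding eq mt by (simp only: ac_simps)
  also have "\<dots> = mset (map (\<lambda>i. s i * s i) [0..<r] @ replicate (n - r) 0) + replicate_mset q 0"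
    unfolding zeros mset_append mset_replicate by (simp only: ac_simps)
  finally have "proots (char_poly (A\<^sup>T * A)) = mset (map (\<lambda>i. s i * s i) [0..<r] @ replicate (n - r) 0)"
    by (simp only: add_right_cancel)
  then have "image_mset sqrt (proots (char_poly (A\<^sup>T * A)))
      = mset (map sqrt (map (\<lambda>i. s i * s i) [0..<r] @ replicate (n - r) 0))"
    by (simp only: mset_map)
  also have "map sqrt (map (\<lambda>i. s i * s i) [0..<r] @ replicate (n - r) 0)
      = map s [0..<r] @ replicate (n - r) 0"
    using 1(9) r(1) by (auto simp: s_def)
  finally have roots: "image_mset sqrt (proots (char_poly (A\<^sup>T * A)))
      = mset (map s [0..<r] @ replicate (n - r) 0)" (is "_ = mset ?xs") .
  have "sorted (rev ?xs)"
    unfolding sorted_rev_iff_nth_mono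
    using 1(9,10) r(1) by (auto simp: nth_append s_def)
  then have "sort ?xs = rev ?xs"
    by (intro properties_for_sort) simp_all
  then have "singular_values A = take r ?xs"
    using 1(1) unfolding singular_values_def roots sorted_list_of_multiset_mset by (simp add: r_def)
  then show ?thesis
    using 1(1) by (simp add: r_def s_def)
qed

lemma singular_value_nonneg:
  assumes svd: "is_svd A U S V"
  shows "0 \<le> singular_value A j"
  using svd
proof (cases rule: is_svdE)
  case (1 m n p q)
  then have "0 \<le> S $$ (i, i)" if "i < min (dim_row A) (dim_col A)" for i
    using that by (metis carrier_matD)
  then show ?thesis
    unfolding singular_value_def singular_values_eq_svd_diagonal[OF svd] by (cases j) auto
qed

section \<open>Truncation\<close>

text \<open>The first \<open>k\<close> columns of \<open>U\<close> are \<open>U J\<close> for a rectangular diagonal \<open>J\<close> of ones, so everything between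
  \<open>U\<close> and \<open>U\<^sup>T\<close> is a product of diagonal matrices. Its entries \<open>s\<^sub>i s\<^sub>i\<^sup>+\<close> are 0 or 1, and 0 exactly where the
  singular value vanishes.\<close>

lemma truncated_factor_projector:
  fixes s :: "nat \<Rightarrow> real"
  assumes U: "U \<in> carrier_mat m p" and k: "k \<le> p"
  defines "Uk \<equiv> leading_block m k U" and "Sk \<equiv> rect_diag k k s"
  shows "Uk * Sk * pinv Sk * Uk\<^sup>T
    = U * rect_diag p p (\<lambda>i. if i < k \<and> s i \<noteq> 0 then 1 else 0) * U\<^sup>T"
proof -
  define J :: "real mat" where "J = rect_diag p k (\<lambda>_. 1)"
  have J: "J \<in> carrier_mat p k" "J\<^sup>T \<in> carrier_mat k p" by (simp_all add: J_def)
  have UJ: "Uk = U * J"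
  proof (rule eq_matI)
    fix i j assume "i < dim_row (U * J)" "j < dim_col (U * J)"
    then have ij: "i < m" "j < k" using U J by auto
    have "(U * J) $$ (i, j) = (\<Sum>l<p. U $$ (i, l) * (if l = j then 1 else 0))"
      using U ij by (simp add: J_def scalar_prod_def lessThan_atLeast0)
    also have "\<dots> = (\<Sum>l<p. if l = j then U $$ (i, j) else 0)"
      by (rule sum.cong) auto
    finally show "Uk $$ (i, j) = (U * J) $$ (i, j)"
      using U ij k by (simp add: Uk_def leading_block_def)
  qed (use U J in \<open>auto simp: Uk_def leading_block_def\<close>)
  let ?D = "rect_diag k k (\<lambda>i. s i * inverse (s i))"
  have UT: "U\<^sup>T \<in> carrier_mat p m" using U by simp
  have Sk: "Sk \<in> carrier_mat k k" "pinv Sk \<in> carrier_mat k k"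
    by (simp_all add: Sk_def pinv_rect_diag)
  have Uk: "Uk \<in> carrier_mat m k" using U J UJ by simp
  have D: "Sk * pinv Sk = ?D"
    unfolding Sk_def pinv_rect_diag rect_diag_mult by (rule rect_diag_cong) simp
  have "Uk * Sk * pinv Sk * Uk\<^sup>T = Uk * (Sk * pinv Sk) * Uk\<^sup>T"
    by (simp only: assoc_mult_mat[OF Uk Sk])
  also have "\<dots> = U * J * ?D * (J\<^sup>T * U\<^sup>T)"
    unfolding D UJ transpose_mult[OF U J(1)] ..
  also have "\<dots> = U * (J * ?D * J\<^sup>T) * U\<^sup>T"
  proof -
    have JD: "J * ?D \<in> carrier_mat p k" "J * ?D * J\<^sup>T \<in> carrier_mat p p" using J by auto
    have "U * J * ?D * (J\<^sup>T * U\<^sup>T) = U * (J * ?D) * (J\<^sup>T * U\<^sup>T)"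
      by (simp only: assoc_mult_mat[OF U J(1) rect_diag_carrier])
    also have "\<dots> = U * (J * ?D) * J\<^sup>T * U\<^sup>T"
      by (rule assoc_mult_mat[OF mult_carrier_mat[OF U JD(1)] J(2) UT, symmetric])
    also have "\<dots> = U * (J * ?D * J\<^sup>T) * U\<^sup>T"
      by (simp only: assoc_mult_mat[OF U JD(1) J(2)])
    finally show ?thesis .
  qed
  also have "J * ?D * J\<^sup>T = rect_diag p p (\<lambda>i. if i < k \<and> s i \<noteq> 0 then 1 else 0)"
    unfolding J_def rect_diag_transpose rect_diag_mult by (rule rect_diag_cong) auto
  finally show ?thesis .
qed

lemma orthonormal_diagonal_mult:
  fixes U :: "real mat"
  assumes U: "U \<in> carrier_mat m p" "U\<^sup>T * U = 1\<^sub>m p"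
    and D: "D \<in> carrier_mat p p" and B: "B \<in> carrier_mat p q"
  shows "U * D * U\<^sup>T * (U * B) = U * (D * B)"
proof -
  have UT: "U\<^sup>T \<in> carrier_mat p m" using U by simp
  have UD: "U * D \<in> carrier_mat m p" and UB: "U * B \<in> carrier_mat m q" using U D B by simp_all
  have "U * D * U\<^sup>T * (U * B) = U * D * ((U\<^sup>T * U) * B)"
    by (simp only: assoc_mult_mat[OF UD UT UB] assoc_mult_mat[OF UT U(1) B])
  also have "\<dots> = U * D * B"
    by (simp only: U(2) left_mult_one_mat[OF B])
  also have "\<dots> = U * (D * B)"
    by (rule assoc_mult_mat[OF U(1) D B])
  finally show ?thesis .
qed

lemma orthonormal_01_projector:
  fixes U :: "real mat" and e :: "nat \<Rightarrow> real"
  assumes U: "U \<in> carrier_mat m p" "U\<^sup>T * U = 1\<^sub>m p" and e: "\<And>i. e i * e i = e i"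
  defines "Q \<equiv> U * rect_diag p p e * U\<^sup>T"
  shows "Q \<in> carrier_mat m m" "Q\<^sup>T = Q" "Q * Q = Q"
proof -
  let ?D = "rect_diag p p e"
  have UT: "U\<^sup>T \<in> carrier_mat p m" using U by simp
  have UD: "U * ?D \<in> carrier_mat m p" and DUT: "?D * U\<^sup>T \<in> carrier_mat p m"
    using mult_carrier_mat[OF U(1) rect_diag_carrier] mult_carrier_mat[OF rect_diag_carrier UT] by auto
  show "Q \<in> carrier_mat m m"
    unfolding Q_def by (rule mult_carrier_mat[OF UD UT])
  have Q': "Q = U * (?D * U\<^sup>T)"
    unfolding Q_def by (rule assoc_mult_mat[OF U(1) rect_diag_carrier UT])
  show "Q\<^sup>T = Q"
    unfolding Q_def transpose_mult[OF UD UT] transpose_mult[OF U(1) rect_diag_carrier] rect_diag_transpose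
    by (simp add: assoc_mult_mat[OF U(1) rect_diag_carrier UT])
  have "Q * Q = Q * (U * (?D * U\<^sup>T))"
    by (simp only: Q'[symmetric])
  also have "\<dots> = U * (?D * (?D * U\<^sup>T))"
    unfolding Q_def by (rule orthonormal_diagonal_mult[OF U rect_diag_carrier DUT])
  also have "?D * (?D * U\<^sup>T) = ?D * ?D * U\<^sup>T"
    by (rule assoc_mult_mat[OF rect_diag_carrier rect_diag_carrier UT, symmetric])
  also have "?D * ?D = ?D"
    unfolding rect_diag_mult by (rule rect_diag_cong) (simp add: e)
  finally show "Q * Q = Q" using Q' by simp
qed

text \<open>Since \<open>A = U S V\<^sup>T\<close>, projecting away the retained directions replaces \<open>S\<close> by the diagonal of the
  discarded singular values, the largest of which has index \<open>k + 1\<close>. A zero singular value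
  among the first \<open>k\<close> contributes nothing either way, so rank deficiency does no harm.\<close>

lemma truncation_residual_le:
  fixes k :: nat
  assumes svd: "is_svd A U S V" and A: "A \<in> carrier_mat m n" and U: "U \<in> carrier_mat m p"
    and y: "y \<in> carrier_vec n"
  defines "Q \<equiv> U * rect_diag p p (\<lambda>i. if i < k \<and> S $$ (i, i) \<noteq> 0 then 1 else 0) * U\<^sup>T"
  shows "vec_norm2 (A *\<^sub>v y - Q *\<^sub>v (A *\<^sub>v y)) \<le> singular_value A (k + 1) * vec_norm2 y"
  using svd
proof (cases rule: is_svdE)
  case (1 m' n' p' q)
  have [simp]: "m' = m" "n' = n" "p' = p" using 1(1,3) A U by auto
  define s where "s i = S $$ (i, i)" for i
  define e :: "nat \<Rightarrow> real" where "e i = (if i < k \<and> s i \<noteq> 0 then 1 else 0)" for i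
  define R where "R = rect_diag p q (\<lambda>i. if i < k then 0 else s i)"
  define c where "c = singular_value A (k + 1)"
  have c: "c = (if k < min p q then s k else 0)"
    using 1(1,2) unfolding c_def singular_value_def singular_values_eq_svd_diagonal[OF svd]
    by (auto simp: s_def)
  have c0: "0 \<le> c" and cs: "\<And>i. i < min p q \<Longrightarrow> k \<le> i \<Longrightarrow> \<bar>s i\<bar> \<le> c"
    using 1(9,10) by (auto simp: c s_def)
  have V: "V \<in> carrier_mat n q" "V\<^sup>T * V = 1\<^sub>m q" and UU: "U\<^sup>T * U = 1\<^sub>m p"
    using 1 by simp_all
  have VT: "V\<^sup>T \<in> carrier_mat q n" using V by simp
  have Ss: "S = rect_diag p q s" using 1(7) by (simp add: s_def[abs_def])
  have S: "S \<in> carrier_mat p q" by (subst Ss) simp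
  have SVT: "S * V\<^sup>T \<in> carrier_mat p n" using S VT by simp
  have A_eq: "A = U * (S * V\<^sup>T)"
    using 1(8) assoc_mult_mat[OF U S VT] by simp
  have Q: "Q \<in> carrier_mat m m"
    unfolding Q_def using U by (intro mult_carrier_mat) auto
  have Q_eq: "Q = U * rect_diag p p e * U\<^sup>T"
    by (simp add: Q_def e_def[abs_def] s_def)
  have w: "V\<^sup>T *\<^sub>v y \<in> carrier_vec q" using VT y by simp
  have QA: "Q * A = U * ((rect_diag p p e * S) * V\<^sup>T)"
    unfolding A_eq Q_eq orthonormal_diagonal_mult[OF U UU rect_diag_carrier SVT]
    using assoc_mult_mat[OF rect_diag_carrier S VT, of p e] by simp
  have eS: "rect_diag p p e * S \<in> carrier_mat p q"
    by (rule mult_carrier_mat[OF rect_diag_carrier S])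
  have "A *\<^sub>v y - Q *\<^sub>v (A *\<^sub>v y) = A *\<^sub>v y - (Q * A) *\<^sub>v y"
    using assoc_mult_mat_vec[OF Q A y] by simp
  also have "\<dots> = U *\<^sub>v (S *\<^sub>v (V\<^sup>T *\<^sub>v y)) - U *\<^sub>v ((rect_diag p p e * S) *\<^sub>v (V\<^sup>T *\<^sub>v y))"
    unfolding QA by (simp only: A_eq assoc_mult_mat_vec[OF U SVT y] assoc_mult_mat_vec[OF S VT y]
      assoc_mult_mat_vec[OF U mult_carrier_mat[OF eS VT] y] assoc_mult_mat_vec[OF eS VT y])
  also have "\<dots> = U *\<^sub>v ((S - rect_diag p p e * S) *\<^sub>v (V\<^sup>T *\<^sub>v y))"
    unfolding minus_mult_distrib_mat_vec[OF S eS w]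
    by (rule mult_minus_distrib_mat_vec[OF U mult_mat_vec_carrier[OF S w] mult_mat_vec_carrier[OF eS w], symmetric])
  also have "S - rect_diag p p e * S = R"
    unfolding Ss rect_diag_mult R_def by (rule eq_matI) (auto simp: e_def)
  finally have "vec_norm2 (A *\<^sub>v y - Q *\<^sub>v (A *\<^sub>v y)) = vec_norm2 (U *\<^sub>v (R *\<^sub>v (V\<^sup>T *\<^sub>v y)))"
    by simp
  also have "\<dots> = vec_norm2 (R *\<^sub>v (V\<^sup>T *\<^sub>v y))"
    by (rule vec_norm2_orthonormal_columns[OF U UU]) (use w in \<open>simp add: R_def carrier_vecI\<close>)
  also have "\<dots> \<le> c * vec_norm2 (V\<^sup>T *\<^sub>v y)"
    unfolding R_def by (rule vec_norm2_rect_diag_mult_le[OF w c0]) (use cs c0 in auto)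
  also have "\<dots> \<le> c * vec_norm2 y"
    by (rule mult_left_mono[OF vec_norm2_transpose_orthonormal_columns_le[OF V y] c0])
  finally show ?thesis by (simp add: c_def)
qed

theorem theorem3p1:
  fixes m n n\<^sub>c k :: nat
    and A\<^sub>f D A\<^sub>c M E\<^sub>I U\<^sub>c S\<^sub>c V\<^sub>c U\<^sub>k S\<^sub>k V\<^sub>k :: "real mat"
  assumes "A\<^sub>f \<in> carrier_mat m n"
    and "D \<in> carrier_mat n n\<^sub>c"
    and "A\<^sub>c = A\<^sub>f * D"
    and "1 \<le> k" and "k \<le> min m n\<^sub>c"
    and "M \<in> carrier_mat n\<^sub>c n"
    and "E\<^sub>I \<in> carrier_mat m n"
    and "A\<^sub>f = A\<^sub>c * M + E\<^sub>I"
    and "is_svd A\<^sub>c U\<^sub>c S\<^sub>c V\<^sub>c"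
    and "U\<^sub>k = leading_block m k U\<^sub>c"
    and "S\<^sub>k = leading_block k k S\<^sub>c"
    and "V\<^sub>k = A\<^sub>f\<^sup>T * U\<^sub>k * pinv S\<^sub>k"
  shows "spectral_norm (A\<^sub>f - U\<^sub>k * S\<^sub>k * V\<^sub>k\<^sup>T)
           \<le> spectral_norm M * singular_value A\<^sub>c (k + 1) + spectral_norm E\<^sub>I"
proof -
  note A\<^sub>f = assms(1) and D = assms(2) and M = assms(6) and E = assms(7) and svd = assms(9)
  have A\<^sub>c: "A\<^sub>c \<in> carrier_mat m n\<^sub>c"
    using A\<^sub>f D assms(3) by simp
  obtain p q where U: "U\<^sub>c \<in> carrier_mat m p" "U\<^sub>c\<^sup>T * U\<^sub>c = 1\<^sub>m p" and "min p q = min m n\<^sub>c"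
    and S: "S\<^sub>c = rect_diag p q (\<lambda>i. S\<^sub>c $$ (i, i))"
    using is_svdE[OF svd] A\<^sub>c by (metis carrier_matD)
  then have k: "k \<le> p" "k \<le> q" using assms(5) by auto
  define s where "s i = S\<^sub>c $$ (i, i)" for i
  define e :: "nat \<Rightarrow> real" where "e i = (if i < k \<and> s i \<noteq> 0 then 1 else 0)" for i
  define Q where "Q = U\<^sub>c * rect_diag p p e * U\<^sub>c\<^sup>T"
  have "S\<^sub>k = rect_diag k k s"
  proof (rule eq_matI)
    fix i j assume "i < dim_row (rect_diag k k s)" "j < dim_col (rect_diag k k s)"
    then show "S\<^sub>k $$ (i, j) = rect_diag k k s $$ (i, j)"
      unfolding assms(11) leading_block_def using k by (subst S) (simp add: s_def)
  qed (simp_all add: assms(11) leading_block_def)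
  then have S\<^sub>k: "S\<^sub>k \<in> carrier_mat k k" "pinv S\<^sub>k \<in> carrier_mat k k" "(pinv S\<^sub>k)\<^sup>T = pinv S\<^sub>k"
    and Q_eq: "U\<^sub>k * S\<^sub>k * pinv S\<^sub>k * U\<^sub>k\<^sup>T = Q"
    using truncated_factor_projector[OF U(1) k(1), of s]
    by (simp_all add: pinv_rect_diag rect_diag_transpose assms(10) Q_def e_def[abs_def])
  have U\<^sub>k: "U\<^sub>k \<in> carrier_mat m k" "U\<^sub>k\<^sup>T \<in> carrier_mat k m"
    by (simp_all add: assms(10) leading_block_def)
  have US: "U\<^sub>k * S\<^sub>k \<in> carrier_mat m k" "U\<^sub>k * S\<^sub>k * pinv S\<^sub>k \<in> carrier_mat m k"
    using U\<^sub>k S\<^sub>k by simp_all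
  have A\<^sub>fT: "A\<^sub>f\<^sup>T \<in> carrier_mat n m" "A\<^sub>f\<^sup>T * U\<^sub>k \<in> carrier_mat n k" using A\<^sub>f U\<^sub>k by simp_all
  have Q: "Q \<in> carrier_mat m m" "Q\<^sup>T = Q" "Q * Q = Q"
    unfolding Q_def by (rule orthonormal_01_projector[OF U], simp add: e_def)+
  \<comment> \<open>The factor \<open>V\<^sub>k\<close> is chosen so that the approximation is the orthogonal projection of \<open>A\<^sub>f\<close>.\<close>
  have "V\<^sub>k\<^sup>T = pinv S\<^sub>k * (U\<^sub>k\<^sup>T * A\<^sub>f)"
    unfolding assms(12) transpose_mult[OF A\<^sub>fT(2) S\<^sub>k(2)] transpose_mult[OF A\<^sub>fT(1) U\<^sub>k(1)] S\<^sub>k(3) by simp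
  then have approx: "U\<^sub>k * S\<^sub>k * V\<^sub>k\<^sup>T = Q * A\<^sub>f"
    using assoc_mult_mat[OF US(1) S\<^sub>k(2) mult_carrier_mat[OF U\<^sub>k(2) A\<^sub>f]]
      assoc_mult_mat[OF US(2) U\<^sub>k(2) A\<^sub>f] Q_eq by metis
  have QA: "Q * A\<^sub>f \<in> carrier_mat m n" using Q A\<^sub>f by simp
  show ?thesis
    unfolding approx
  proof (rule spectral_norm_le[OF minus_carrier_mat[OF QA]])
    fix x :: "real vec" assume x: "x \<in> carrier_vec n" "vec_norm2 x \<le> 1"
    let ?y = "M *\<^sub>v x" and ?z = "E\<^sub>I *\<^sub>v x"
    have y: "?y \<in> carrier_vec n\<^sub>c" and z: "?z \<in> carrier_vec m"
      and Ay: "A\<^sub>c *\<^sub>v ?y \<in> carrier_vec m" using M E A\<^sub>c x by simp_all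
    have "A\<^sub>f *\<^sub>v x = A\<^sub>c *\<^sub>v ?y + ?z"
      unfolding assms(8) add_mult_distrib_mat_vec[OF mult_carrier_mat[OF A\<^sub>c M] E x(1)]
        assoc_mult_mat_vec[OF A\<^sub>c M x(1)] ..
    then have "(A\<^sub>f - Q * A\<^sub>f) *\<^sub>v x = (A\<^sub>c *\<^sub>v ?y + ?z) - Q *\<^sub>v (A\<^sub>c *\<^sub>v ?y + ?z)"
      unfolding minus_mult_distrib_mat_vec[OF A\<^sub>f QA x(1)] assoc_mult_mat_vec[OF Q(1) A\<^sub>f x(1)] by simp
    also have "\<dots> = (A\<^sub>c *\<^sub>v ?y - Q *\<^sub>v (A\<^sub>c *\<^sub>v ?y)) + (?z - Q *\<^sub>v ?z)"
    proof -
      have "(a + b) - (c + d) = (a - c) + (b - d)"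
        if "a \<in> carrier_vec m" "b \<in> carrier_vec m" "c \<in> carrier_vec m" "d \<in> carrier_vec m"
        for a b c d :: "real vec"
        by (rule eq_vecI) (use that in auto)
      from this[OF Ay z mult_mat_vec_carrier[OF Q(1) Ay] mult_mat_vec_carrier[OF Q(1) z]]
      show ?thesis unfolding mult_add_distrib_mat_vec[OF Q(1) Ay z] .
    qed
    finally have split_x: "(A\<^sub>f - Q * A\<^sub>f) *\<^sub>v x
      = (A\<^sub>c *\<^sub>v ?y - Q *\<^sub>v (A\<^sub>c *\<^sub>v ?y)) + (?z - Q *\<^sub>v ?z)" .
    have "vec_norm2 ((A\<^sub>f - Q * A\<^sub>f) *\<^sub>v x)
        \<le> vec_norm2 (A\<^sub>c *\<^sub>v ?y - Q *\<^sub>v (A\<^sub>c *\<^sub>v ?y)) + vec_norm2 (?z - Q *\<^sub>v ?z)"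
      unfolding split_x by (rule vec_norm2_triangle[of _ m])
        (use Ay z Q(1) in \<open>auto intro!: minus_carrier_vec mult_mat_vec_carrier\<close>)
    also have "vec_norm2 (A\<^sub>c *\<^sub>v ?y - Q *\<^sub>v (A\<^sub>c *\<^sub>v ?y)) \<le> singular_value A\<^sub>c (k + 1) * vec_norm2 ?y"
      using truncation_residual_le[OF svd A\<^sub>c U(1) y, of k]
      by (simp add: Q_def e_def[abs_def] s_def)
    also have "\<dots> \<le> singular_value A\<^sub>c (k + 1) * spectral_norm M"
      by (rule mult_left_mono[OF vec_norm2_mult_le_spectral_norm[OF M x] singular_value_nonneg[OF svd]])
    also have "vec_norm2 (?z - Q *\<^sub>v ?z) \<le> vec_norm2 ?z"
      by (rule vec_norm2_projector_le[OF Q z])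
    also have "\<dots> \<le> spectral_norm E\<^sub>I"
      by (rule vec_norm2_mult_le_spectral_norm[OF E x])
    finally show "vec_norm2 ((A\<^sub>f - Q * A\<^sub>f) *\<^sub>v x)
        \<le> spectral_norm M * singular_value A\<^sub>c (k + 1) + spectral_norm E\<^sub>I"
      by (simp add: mult.commute)
  qed
qed

end
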